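(* Let $N\ge1$, $\mathfrak{g}=\mathfrak{gl}_N(\mathbb{C})$, and let $A$ be a commutative associative unital $\mathbb{C}$-algebra. Let $S$ be a disjoint union of finitely many circuits, $m=|S|\geq 1$, $\sigma$ any order of the elements of $S$, and $\underline{a}_m\in A^m$. Then $T_m(S,\sigma,\underline{a}_m)$ is central, i.e. it commutes in $U(\mathfrak{g}\otimes A)$ with $x\otimes 1$ for every $x\in\mathfrak{g}$.
   Context: $\mathfrak{g}\otimes A$ has bracket $[x\otimes a,y\otimes b]=[x,y]\otimes ab$; $E_{ij}$ ($1\le i,j\le N$) are the matrix units of $\mathfrak{gl}_N$ and $E_{ij}(a)=E_{ij}\otimes a$. Circuits: consider finite non-empty sets $S$ of ordered pairs $(x,y)$ of symbols ("index variables"); $x$ is the start point and $y$ the end point of $(x,y)$. Two pairs $(x,y),(z,w)$ are connected if $y=z$ or $x=w$. $S$ is a circuit if (1) each variable occurs at most once as a start point and at most once as an end point; (2) a variable occurring as a start point also occurs as an end point, and conversely; (3) any two elements of $S$ can be joined by a sequence of elements of $S$ in which consecutive elements are connected. Equivalently, up to renaming, $S=\{(i_1,i_2),(i_2,i_3),\dots,(i_m,i_1)\}$ with $i_1,\dots,i_m$ distinct variables ($\{(i_1,i_1)\}$ when $m=1$). In a disjoint union of circuits, different circuits involve disjoint sets of variables. An order $\sigma$ of $S$ with $|S|=m$ is a listing $(x_1,y_1),\dots,(x_m,y_m)$ of all the elements of $S$. For $\underline{a}_m=(a_1,\dots,a_m)\in A^m$ define $$T_m(S,\sigma,\underline{a}_m)=\sum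 E_{x_1y_1}(a_1)E_{x_2y_2}(a_2)\cdots E_{x_my_m}(a_m)\in U(\mathfrak{g}\otimes A),$$ where the sum runs over all assignments of values in $\{1,\dots,N\}$ to the variables occurring in $S$. *)

theory Defs
  imports "HOL-Analysis.Analysis" "HOL-Library.Poly_Mapping"
begin

section \<open>Complex vector spaces, algebras and Lie algebras\<close>

class scaleC =
  fixes scaleC :: "complex \<Rightarrow> 'a \<Rightarrow> 'a" (infixr \<open>*\<^sub>C\<close> 75)

class complex_vector = scaleC + ab_group_add +
  assumes scaleC_add_right: "c *\<^sub>C (x + y) = c *\<^sub>C x + c *\<^sub>C y"
    and scaleC_add_left: "(c + d) *\<^sub>C x = c *\<^sub>C x + d *\<^sub>C x"
    and scaleC_scaleC [simp]: "c *\<^sub>C d *\<^sub>C x = (c * d) *\<^sub>C x"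
    and scaleC_one [simp]: "1 *\<^sub>C x = x"

global_interpretation complex_vector: vector_space "scaleC :: complex \<Rightarrow> 'a \<Rightarrow> 'a::complex_vector"
  by unfold_locales (rule scaleC_add_right scaleC_add_left scaleC_scaleC scaleC_one)+

text \<open>Here and below, algebras are associative and unital; \<open>0 \<noteq> 1\<close> is not required,
  so that the zero algebra is included.\<close>

class complex_algebra_1 = complex_vector + ring + monoid_mult +
  assumes scaleC_mult_left: "(c *\<^sub>C x) * y = c *\<^sub>C (x * y)"
    and scaleC_mult_right: "x * (c *\<^sub>C y) = c *\<^sub>C (x * y)"

class complex_comm_algebra_1 = complex_algebra_1 + comm_ring

class complex_lie_algebra = complex_vector +
  fixes lie :: "'a \<Rightarrow> 'a \<Rightarrow> 'a"
  assumes lie_add_left: "lie (x + y) z = lie x z + lie y z"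
    and lie_add_right: "lie x (y + z) = lie x y + lie x z"
    and lie_scaleC_left: "lie (c *\<^sub>C x) y = c *\<^sub>C lie x y"
    and lie_scaleC_right: "lie x (c *\<^sub>C y) = c *\<^sub>C lie x y"
    and lie_self [simp]: "lie x x = 0"
    and lie_jacobi: "lie x (lie y z) + lie y (lie z x) + lie z (lie x y) = 0"

definition bilinearC :: "('a::complex_vector \<Rightarrow> 'b::complex_vector \<Rightarrow> 'c::complex_vector) \<Rightarrow> bool" where
  "bilinearC \<phi> \<longleftrightarrow>
    (\<forall>x x' b. \<phi> (x + x') b = \<phi> x b + \<phi> x' b) \<and> (\<forall>x b b'. \<phi> x (b + b') = \<phi> x b + \<phi> x b') \<and>
    (\<forall>c x b. \<phi> (c *\<^sub>C x) b = c *\<^sub>C \<phi> x b) \<and> (\<forall>c x b. \<phi> x (c *\<^sub>C b) = c *\<^sub>C \<phi> x b)"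

lemma lie_skew: "lie y x = - lie x (y::'a::complex_lie_algebra)"
proof -
  have "lie (x + y) (x + y) = lie x x + lie x y + (lie y x + lie y y)"
    by (simp only: lie_add_left lie_add_right) (simp add: algebra_simps)
  then have "lie x y + lie y x = 0" by simp
  then show ?thesis by (simp add: eq_neg_iff_add_eq_0 add.commute)
qed

lemma lie_zero_left [simp]: "lie 0 (y::'a::complex_lie_algebra) = 0"
  using lie_add_left[of 0 0 y] by simp

lemma lie_zero_right [simp]: "lie (y::'a::complex_lie_algebra) 0 = 0"
  using lie_add_right[of y 0 0] by simp


section \<open>The free complex vector space on a type\<close>

instantiation complex :: scaleC
begin
definition "scaleC_complex (c::complex) (x::complex) = c * x"
instance ..
end

instance complex :: complex_comm_algebra_1
  by standard (simp_all add: scaleC_complex_def algebra_simps)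

instantiation poly_mapping :: (type, complex_vector) complex_vector
begin

definition scaleC_poly_mapping :: "complex \<Rightarrow> ('a \<Rightarrow>\<^sub>0 'b) \<Rightarrow> 'a \<Rightarrow>\<^sub>0 'b" where
  "scaleC_poly_mapping c f = Poly_Mapping.map ((*\<^sub>C) c) f"

lemma lookup_scaleC: "Poly_Mapping.lookup (c *\<^sub>C f) k = c *\<^sub>C Poly_Mapping.lookup f k" for f :: "'a \<Rightarrow>\<^sub>0 'b"
  by (simp add: scaleC_poly_mapping_def Poly_Mapping.map.rep_eq when_def)

instance
  by standard (auto intro!: poly_mapping_eqI
      simp: lookup_scaleC lookup_add scaleC_add_right scaleC_add_left)

end

definition free_lift :: "('p \<Rightarrow> 'c::complex_vector) \<Rightarrow> ('p \<Rightarrow>\<^sub>0 complex) \<Rightarrow> 'c" where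
  "free_lift \<phi> f = (\<Sum>p\<in>Poly_Mapping.keys f. Poly_Mapping.lookup f p *\<^sub>C \<phi> p)"

lemma free_lift_superset:
  assumes "finite K" "Poly_Mapping.keys f \<subseteq> K"
  shows "free_lift \<phi> f = (\<Sum>p\<in>K. Poly_Mapping.lookup f p *\<^sub>C \<phi> p)"
  unfolding free_lift_def
  by (rule sum.mono_neutral_left) (use assms in \<open>auto simp: in_keys_iff\<close>)

lemma free_lift_add: "free_lift \<phi> (f + g) = free_lift \<phi> f + free_lift \<phi> g"
proof -
  let ?K = "Poly_Mapping.keys f \<union> Poly_Mapping.keys g"
  have "Poly_Mapping.keys (f + g) \<subseteq> ?K" by (rule keys_add)
  then show ?thesis
    by (simp add: free_lift_superset[of ?K] lookup_add scaleC_add_left sum.distrib)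
qed

lemma free_lift_scaleC: "free_lift \<phi> (c *\<^sub>C f) = c *\<^sub>C free_lift \<phi> f"
proof -
  have "Poly_Mapping.keys (c *\<^sub>C f) \<subseteq> Poly_Mapping.keys f"
    by (auto simp: in_keys_iff lookup_scaleC scaleC_complex_def)
  then show ?thesis
    by (simp add: free_lift_superset[of "Poly_Mapping.keys f"] lookup_scaleC complex_vector.scale_sum_right
        scaleC_complex_def)
qed

lemma free_lift_zero [simp]: "free_lift \<phi> 0 = 0"
  by (simp add: free_lift_def)

lemma free_lift_diff: "free_lift \<phi> (f - g) = free_lift \<phi> f - free_lift \<phi> g"
  using free_lift_add[of \<phi> "f - g" g] by (simp add: algebra_simps)

lemma free_lift_single [simp]: "free_lift \<phi> (Poly_Mapping.single p 1) = \<phi> p"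
  by (simp add: free_lift_def)


section \<open>The tensor product over the complex numbers\<close>

definition tensor_relators :: "('a::complex_vector \<times> 'b::complex_vector \<Rightarrow>\<^sub>0 complex) set" where
  "tensor_relators =
    {Poly_Mapping.single (x + x', b) 1 - Poly_Mapping.single (x, b) 1 - Poly_Mapping.single (x', b) 1
      | x x' b. True} \<union>
    {Poly_Mapping.single (x, b + b') 1 - Poly_Mapping.single (x, b) 1 - Poly_Mapping.single (x, b') 1
      | x b b'. True} \<union>
    {Poly_Mapping.single (c *\<^sub>C x, b) 1 - c *\<^sub>C Poly_Mapping.single (x, b) 1 | c x b. True} \<union>
    {Poly_Mapping.single (x, c *\<^sub>C b) 1 - c *\<^sub>C Poly_Mapping.single (x, b) 1 | c x b. True}"

quotient_type (overloaded) ('a, 'b) tensor =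
  "'a::complex_vector \<times> 'b::complex_vector \<Rightarrow>\<^sub>0 complex" /
  "\<lambda>f g. f - g \<in> complex_vector.span tensor_relators"
proof (rule equivpI)
  show "reflp (\<lambda>f g. f - g \<in> complex_vector.span (tensor_relators :: ('a \<times> 'b \<Rightarrow>\<^sub>0 complex) set))"
    by (rule reflpI) (simp add: complex_vector.span_zero)
  show "symp (\<lambda>f g. f - g \<in> complex_vector.span (tensor_relators :: ('a \<times> 'b \<Rightarrow>\<^sub>0 complex) set))"
    by (rule sympI) (use complex_vector.span_neg in \<open>fastforce\<close>)
  show "transp (\<lambda>f g. f - g \<in> complex_vector.span (tensor_relators :: ('a \<times> 'b \<Rightarrow>\<^sub>0 complex) set))"
    by (rule transpI) (use complex_vector.span_add in \<open>fastforce\<close>)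
qed

instantiation tensor :: (complex_vector, complex_vector) complex_vector
begin

lift_definition zero_tensor :: "('a, 'b) tensor" is 0 .

lift_definition plus_tensor :: "('a, 'b) tensor \<Rightarrow> ('a, 'b) tensor \<Rightarrow> ('a, 'b) tensor" is "(+)"
  using complex_vector.span_add by (fastforce simp: algebra_simps)

lift_definition uminus_tensor :: "('a, 'b) tensor \<Rightarrow> ('a, 'b) tensor" is uminus
  using complex_vector.span_neg by (fastforce simp: algebra_simps)

lift_definition minus_tensor :: "('a, 'b) tensor \<Rightarrow> ('a, 'b) tensor \<Rightarrow> ('a, 'b) tensor" is "(-)"
  using complex_vector.span_diff by (fastforce simp: algebra_simps)

lift_definition scaleC_tensor :: "complex \<Rightarrow> ('a, 'b) tensor \<Rightarrow> ('a, 'b) tensor" is "(*\<^sub>C)"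
  by (metis complex_vector.scale_right_diff_distrib complex_vector.span_scale)

instance
  by standard
    (transfer; simp add: complex_vector.span_zero algebra_simps scaleC_add_left scaleC_add_right)+

end

lift_definition pure_tensor :: "'a::complex_vector \<Rightarrow> 'b::complex_vector \<Rightarrow> ('a, 'b) tensor"
  (infixl \<open>\<otimes>\<^sub>C\<close> 70) is "\<lambda>x b. Poly_Mapping.single (x, b) 1" .

lemma pure_tensor_add_left: "(x + x') \<otimes>\<^sub>C b = x \<otimes>\<^sub>C b + x' \<otimes>\<^sub>C b"
  by transfer (rule complex_vector.span_base, unfold tensor_relators_def diff_diff_eq[symmetric], blast)

lemma pure_tensor_add_right: "x \<otimes>\<^sub>C (b + b') = x \<otimes>\<^sub>C b + x \<otimes>\<^sub>C b'"
  by transfer (rule complex_vector.span_base, unfold tensor_relators_def diff_diff_eq[symmetric], blast)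

lemma pure_tensor_scaleC_left: "(c *\<^sub>C x) \<otimes>\<^sub>C b = c *\<^sub>C (x \<otimes>\<^sub>C b)"
  by transfer (rule complex_vector.span_base, unfold tensor_relators_def, blast)

lemma pure_tensor_scaleC_right: "x \<otimes>\<^sub>C (c *\<^sub>C b) = c *\<^sub>C (x \<otimes>\<^sub>C b)"
  by transfer (rule complex_vector.span_base, unfold tensor_relators_def, blast)

lemmas pure_tensor_linear = pure_tensor_add_left pure_tensor_add_right
  pure_tensor_scaleC_left pure_tensor_scaleC_right

lemma tensor_induct [case_names pure add, induct type: tensor]:
  assumes pure: "\<And>x b. P (x \<otimes>\<^sub>C b)" and add: "\<And>s t. P s \<Longrightarrow> P t \<Longrightarrow> P (s + t)"
  shows "P t"
proof (induct t rule: tensor.abs_induct)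
  case (1 f)
  have "f = (\<Sum>p\<in>Poly_Mapping.keys f. Poly_Mapping.lookup f p *\<^sub>C Poly_Mapping.single p 1)"
    by (rule poly_mapping_eqI)
      (auto simp: lookup_sum lookup_scaleC scaleC_complex_def lookup_single when_def
        in_keys_iff sum.delta if_distrib cong: if_cong)
  moreover have "P (abs_tensor (\<Sum>p\<in>K. Poly_Mapping.lookup f p *\<^sub>C Poly_Mapping.single p 1))" if "finite K" for K
    using that
  proof induct
    case empty
    have "P (0 \<otimes>\<^sub>C 0)" by (rule pure)
    also have "0 \<otimes>\<^sub>C 0 = abs_tensor (0 :: 'a \<times> 'b \<Rightarrow>\<^sub>0 complex)"
      using pure_tensor_scaleC_left[of 0 0 0] by (simp add: zero_tensor_def)
    finally show ?case by simp
  next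
    case (insert p K)
    obtain x b where p: "p = (x, b)" by force
    have "abs_tensor (Poly_Mapping.lookup f p *\<^sub>C Poly_Mapping.single p 1) = (Poly_Mapping.lookup f p *\<^sub>C x) \<otimes>\<^sub>C b"
      unfolding pure_tensor_scaleC_left by (simp add: p pure_tensor.abs_eq scaleC_tensor.abs_eq)
    then show ?case
      using insert pure add by (simp add: plus_tensor.abs_eq[symmetric])
  qed
  ultimately show ?case by (metis finite_keys)
qed

text \<open>For bilinear \<open>\<phi>\<close>, the following is the linear map on the tensor product
  that is induced by \<open>\<phi>\<close>. The choice of a representative does not matter then.\<close>

definition tensor_lift ::
    "('a::complex_vector \<Rightarrow> 'b::complex_vector \<Rightarrow> 'c::complex_vector) \<Rightarrow> ('a, 'b) tensor \<Rightarrow> 'c" where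
  "tensor_lift \<phi> t = free_lift (case_prod \<phi>) (rep_tensor t)"

lemma tensor_lift_abs:
  assumes "bilinearC \<phi>"
  shows "tensor_lift \<phi> (abs_tensor f) = free_lift (case_prod \<phi>) f"
proof -
  have *: "free_lift (case_prod \<phi>) g = 0" if "g \<in> complex_vector.span tensor_relators" for g
    using that
  proof (induct rule: complex_vector.span_induct_alt)
    case base
    show ?case by simp
  next
    case (step c r g)
    have "free_lift (case_prod \<phi>) r = 0"
      using step(1) assms unfolding tensor_relators_def bilinearC_def
      by (auto simp: free_lift_diff free_lift_scaleC)
    then show ?case using step(2) by (simp add: free_lift_add free_lift_scaleC)
  qed
  have "rep_tensor (abs_tensor f) - f \<in> complex_vector.span tensor_relators"
    using Quotient3_rep_abs[OF Quotient3_tensor, of f] by (simp add: complex_vector.span_zero)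
  from *[OF this] show ?thesis by (simp add: tensor_lift_def free_lift_diff)
qed

lemma tensor_lift_pure [simp]: "bilinearC \<phi> \<Longrightarrow> tensor_lift \<phi> (x \<otimes>\<^sub>C b) = \<phi> x b"
  by (simp add: pure_tensor.abs_eq tensor_lift_abs)

lemma tensor_lift_add: "bilinearC \<phi> \<Longrightarrow> tensor_lift \<phi> (s + t) = tensor_lift \<phi> s + tensor_lift \<phi> t"
  by (induct s rule: tensor.abs_induct, induct t rule: tensor.abs_induct)
    (simp add: plus_tensor.abs_eq tensor_lift_abs free_lift_add)

lemma tensor_lift_scaleC: "bilinearC \<phi> \<Longrightarrow> tensor_lift \<phi> (c *\<^sub>C t) = c *\<^sub>C tensor_lift \<phi> t"
  by (induct t rule: tensor.abs_induct)
    (simp add: scaleC_tensor.abs_eq tensor_lift_abs free_lift_scaleC)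


section \<open>The Lie algebra structure on the tensor product\<close>

instantiation tensor :: (complex_lie_algebra, complex_comm_algebra_1) complex_lie_algebra
begin

definition lie_tensor :: "('a, 'b) tensor \<Rightarrow> ('a, 'b) tensor \<Rightarrow> ('a, 'b) tensor" where
  "lie_tensor s t = tensor_lift (\<lambda>x a. tensor_lift (\<lambda>y b. lie x y \<otimes>\<^sub>C (a * b)) t) s"

lemma lie_tensor_bilinear_inner: "bilinearC (\<lambda>y b. lie x y \<otimes>\<^sub>C (a * b))"
  for x :: 'a and a :: 'b
  by (simp add: bilinearC_def lie_add_right lie_scaleC_right pure_tensor_linear
      distrib_left scaleC_mult_right)

lemma lie_tensor_bilinear_pure: "bilinearC (\<lambda>x a. lie x y \<otimes>\<^sub>C (a * b))"
  for y :: 'a and b :: 'b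
  by (simp add: bilinearC_def lie_add_left lie_scaleC_left pure_tensor_linear
      distrib_right scaleC_mult_left)

lemma lie_tensor_bilinear_outer:
  "bilinearC (\<lambda>x a. tensor_lift (\<lambda>y b. lie x y \<otimes>\<^sub>C (a * b)) t)" for t :: "('a, 'b) tensor"
proof (induct t)
  case (pure y b)
  show ?case
    by (simp add: lie_tensor_bilinear_inner lie_tensor_bilinear_pure)
next
  case (add s t)
  then show ?case
    by (simp add: tensor_lift_add[OF lie_tensor_bilinear_inner])
      (simp add: bilinearC_def scaleC_add_right algebra_simps)
qed

lemma lie_pure_tensor: "lie (x \<otimes>\<^sub>C a) (y \<otimes>\<^sub>C b) = lie x y \<otimes>\<^sub>C (a * b)"
  for x y :: 'a and a b :: 'b
  by (simp add: lie_tensor_def lie_tensor_bilinear_inner lie_tensor_bilinear_pure)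

instance
proof
  fix r s t :: "('a, 'b) tensor" and c :: complex
  have add_left: "lie (r + s) t = lie r t + lie s t" for r s t :: "('a, 'b) tensor"
    by (simp add: lie_tensor_def tensor_lift_add lie_tensor_bilinear_outer)
  have pure_left: "lie (x \<otimes>\<^sub>C a) t = tensor_lift (\<lambda>y b. lie x y \<otimes>\<^sub>C (a * b)) t"
    for x :: 'a and a :: 'b and t
    by (simp add: lie_tensor_def lie_tensor_bilinear_outer)
  have add_right: "lie r (s + t) = lie r s + lie r t" for r s t :: "('a, 'b) tensor"
    by (induct r) (simp_all add: add_left pure_left tensor_lift_add lie_tensor_bilinear_inner)
  have skew: "lie s t + lie t s = 0" for s t :: "('a, 'b) tensor"
  proof (induct s)
    case (pure x a)
    show ?case
    proof (induct t)
      case (pure y b)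
      have "lie (y \<otimes>\<^sub>C b) (x \<otimes>\<^sub>C a) = (- lie x y) \<otimes>\<^sub>C (a * b)"
        by (simp add: lie_pure_tensor mult.commute[of b a] lie_skew[of y x])
      moreover have "(- z) \<otimes>\<^sub>C e = - (z \<otimes>\<^sub>C e)" for z :: 'a and e :: 'b
        using pure_tensor_scaleC_left[of "- 1" z e] by simp
      ultimately show ?case by (simp add: lie_pure_tensor)
    next
      case (add t t')
      have "lie (x \<otimes>\<^sub>C a) (t + t') + lie (t + t') (x \<otimes>\<^sub>C a) =
          (lie (x \<otimes>\<^sub>C a) t + lie t (x \<otimes>\<^sub>C a)) + (lie (x \<otimes>\<^sub>C a) t' + lie t' (x \<otimes>\<^sub>C a))"
        by (simp add: add_left add_right)
      then show ?case by (simp add: add)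
    qed
  next
    case (add s s')
    have "lie (s + s') t + lie t (s + s') = (lie s t + lie t s) + (lie s' t + lie t s')"
      by (simp add: add_left add_right)
    then show ?case by (simp add: add)
  qed
  show "lie (r + s) t = lie r t + lie s t" by (rule add_left)
  show "lie r (s + t) = lie r s + lie r t" by (rule add_right)
  show "lie (c *\<^sub>C s) t = c *\<^sub>C lie s t"
    by (simp add: lie_tensor_def tensor_lift_scaleC lie_tensor_bilinear_outer)
  show "lie s (c *\<^sub>C t) = c *\<^sub>C lie s t"
    by (induct s) (simp_all add: add_left pure_left tensor_lift_scaleC
        lie_tensor_bilinear_inner scaleC_add_right)
  show "lie s s = 0"
  proof -
    have "(2::complex) *\<^sub>C lie s s = 0"
      using skew[of s s] scaleC_add_left[of 1 1 "lie s s"] by simp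
    then show ?thesis by simp
  qed
  define J where "J r s t = lie r (lie s t) + lie s (lie t r) + lie t (lie r s)"
    for r s t :: "('a, 'b) tensor"
  have J_add: "J (r + r') s t = J r s t + J r' s t" "J r (s + s') t = J r s t + J r s' t"
    "J r s (t + t') = J r s t + J r s t'" for r r' s s' t t'
    by (simp_all add: J_def add_left add_right algebra_simps)
  have "J r s t = 0"
  proof (induct r)
    case (pure x a)
    show ?case
    proof (induct s)
      case (pure y b)
      show ?case
      proof (induct t)
        case (pure z d)
        have "b * (d * a) = a * (b * d)" "d * (a * b) = a * (b * d)" by (simp_all add: ac_simps)
        moreover have "(0::'a) \<otimes>\<^sub>C e = 0" for e :: 'b
          using pure_tensor_scaleC_left[of 0 0 e] by simp
        ultimately show ?case
          by (simp add: J_def lie_pure_tensor pure_tensor_add_left[symmetric] lie_jacobi)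
      next
        case (add t t')
        then show ?case by (simp add: J_add)
      qed
    next
      case (add s s')
      then show ?case by (simp add: J_add)
    qed
  next
    case (add r r')
    then show ?case by (simp add: J_add)
  qed
  then show "lie r (lie s t) + lie s (lie t r) + lie t (lie r s) = 0" by (simp add: J_def)
qed

end


section \<open>Universal enveloping algebras\<close>

text \<open>The universal enveloping algebra of \<open>L\<close> is the free associative unital algebra on the
  underlying set of \<open>L\<close> modulo the relations saying that the canonical map from \<open>L\<close> is linear
  (which turn the free algebra into the tensor algebra of \<open>L\<close>) and the relations
  \<open>x y - y x = [x, y]\<close>.\<close>

datatype 'l free_monoid = Free_Monoid "'l list"

instantiation free_monoid :: (type) monoid_add
begin

definition "0 = Free_Monoid []"

fun plus_free_monoid :: "'a free_monoid \<Rightarrow> 'a free_monoid \<Rightarrow> 'a free_monoid" where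
  "Free_Monoid u + Free_Monoid v = Free_Monoid (u @ v)"

instance
proof
  fix u v w :: "'a free_monoid"
  show "u + v + w = u + (v + w)" by (cases u; cases v; cases w) simp
  show "0 + u = u" "u + 0 = u" by (cases u; simp add: zero_free_monoid_def)+
qed

end

type_synonym 'l free_algebra = "'l free_monoid \<Rightarrow>\<^sub>0 complex"

definition free_gen :: "'l \<Rightarrow> 'l free_algebra" where
  "free_gen x = Poly_Mapping.single (Free_Monoid [x]) 1"

inductive_set two_sided_ideal :: "'r::ring_1 set \<Rightarrow> 'r set" for R :: "'r set" where
  zero: "0 \<in> two_sided_ideal R"
| base: "r \<in> R \<Longrightarrow> r \<in> two_sided_ideal R"
| add: "f \<in> two_sided_ideal R \<Longrightarrow> g \<in> two_sided_ideal R \<Longrightarrow> f + g \<in> two_sided_ideal R"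
| mult_left: "f \<in> two_sided_ideal R \<Longrightarrow> h * f \<in> two_sided_ideal R"
| mult_right: "f \<in> two_sided_ideal R \<Longrightarrow> f * h \<in> two_sided_ideal R"

lemma two_sided_ideal_minus: "f \<in> two_sided_ideal R \<Longrightarrow> - f \<in> two_sided_ideal R"
  using two_sided_ideal.mult_left[of f R "- 1"] by simp

lemma two_sided_ideal_diff:
  "f \<in> two_sided_ideal R \<Longrightarrow> g \<in> two_sided_ideal R \<Longrightarrow> f - g \<in> two_sided_ideal R"
  using two_sided_ideal.add[of f R "- g"] two_sided_ideal_minus[of g R] by simp

definition uea_relators :: "'l::complex_lie_algebra free_algebra set" where
  "uea_relators =
    {free_gen (x + y) - free_gen x - free_gen y | x y. True} \<union>
    {free_gen (c *\<^sub>C x) - c *\<^sub>C free_gen x | c x. True} \<union>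
    {free_gen x * free_gen y - free_gen y * free_gen x - free_gen (lie x y) | x y. True}"

quotient_type (overloaded) 'l uea = "'l::complex_lie_algebra free_algebra" /
  "\<lambda>f g. f - g \<in> two_sided_ideal uea_relators"
proof (rule equivpI)
  show "reflp (\<lambda>f g. f - g \<in> two_sided_ideal (uea_relators :: 'l free_algebra set))"
    by (rule reflpI) (simp add: two_sided_ideal.zero)
  show "symp (\<lambda>f g. f - g \<in> two_sided_ideal (uea_relators :: 'l free_algebra set))"
    by (rule sympI) (use two_sided_ideal_minus in \<open>fastforce\<close>)
  show "transp (\<lambda>f g. f - g \<in> two_sided_ideal (uea_relators :: 'l free_algebra set))"
    by (rule transpI) (use two_sided_ideal.add in \<open>fastforce\<close>)
qed

lemma scaleC_free_algebra: "c *\<^sub>C f = Poly_Mapping.single 0 c * f" for f :: "'l free_algebra"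
  unfolding mult_map_scale_conv_mult[symmetric] scaleC_poly_mapping_def
  by (simp add: scaleC_complex_def[abs_def])

lemma free_algebra_scaleC_right: "f * (c *\<^sub>C g) = c *\<^sub>C (f * g)" for f g :: "'l free_algebra"
proof -
  have *: "f * Poly_Mapping.single 0 c = Poly_Mapping.single 0 c * f"
  proof (rule poly_mapping_eqI)
    fix k
    have "((c when q = 0) when k = l + q) = ((c when l = k) when q = 0)" for l q :: "'l free_monoid"
      by (auto simp: when_def)
    moreover have "((c when l = 0) * (\<Sum>q. Poly_Mapping.lookup f q when k = l + q)) =
        (c * Poly_Mapping.lookup f k when l = 0)" for l :: "'l free_monoid"
      by (cases "l = 0") (simp_all add: when_def[of _ "k = _"])
    ultimately show "Poly_Mapping.lookup (f * Poly_Mapping.single 0 c) k =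
        Poly_Mapping.lookup (Poly_Mapping.single 0 c * f) k"
      by (simp add: lookup_mult lookup_single eq_commute[of 0] mult_when mult.commute)
  qed
  then show ?thesis by (metis scaleC_free_algebra mult.assoc)
qed

instantiation uea :: (complex_lie_algebra) complex_algebra_1
begin

lift_definition zero_uea :: "'a uea" is 0 .

lift_definition one_uea :: "'a uea" is 1 .

lift_definition plus_uea :: "'a uea \<Rightarrow> 'a uea \<Rightarrow> 'a uea" is "(+)"
  using two_sided_ideal.add by (fastforce simp: algebra_simps)

lift_definition uminus_uea :: "'a uea \<Rightarrow> 'a uea" is uminus
  using two_sided_ideal_minus by (fastforce simp: algebra_simps)

lift_definition minus_uea :: "'a uea \<Rightarrow> 'a uea \<Rightarrow> 'a uea" is "(-)"
  using two_sided_ideal_diff by (fastforce simp: algebra_simps)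

lift_definition times_uea :: "'a uea \<Rightarrow> 'a uea \<Rightarrow> 'a uea" is "(*)"
proof -
  fix f f' g g' :: "'a free_algebra"
  assume "f - f' \<in> two_sided_ideal uea_relators" "g - g' \<in> two_sided_ideal uea_relators"
  then have "(f - f') * g + f' * (g - g') \<in> two_sided_ideal uea_relators"
    by (intro two_sided_ideal.add two_sided_ideal.mult_left two_sided_ideal.mult_right)
  then show "f * g - f' * g' \<in> two_sided_ideal uea_relators" by (simp add: algebra_simps)
qed

lift_definition scaleC_uea :: "complex \<Rightarrow> 'a uea \<Rightarrow> 'a uea" is "(*\<^sub>C)"
  by (metis complex_vector.scale_right_diff_distrib scaleC_free_algebra two_sided_ideal.mult_left)

instance
proof
  fix u v w :: "'a uea" and c d :: complex
  have left: "(c *\<^sub>C f) * g = c *\<^sub>C (f * g)" for c and f g :: "'a free_algebra"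
    by (simp add: scaleC_free_algebra mult.assoc)
  show "u * v * w = u * (v * w)" "1 * u = u" "u * 1 = u"
    "u + v + w = u + (v + w)" "u + v = v + u" "0 + u = u" "- u + u = 0" "u - v = u + - v"
    "(u + v) * w = u * w + v * w" "u * (v + w) = u * v + u * w"
    by (transfer; simp add: two_sided_ideal.zero algebra_simps)+
  show "c *\<^sub>C (u + v) = c *\<^sub>C u + c *\<^sub>C v" "(c + d) *\<^sub>C u = c *\<^sub>C u + d *\<^sub>C u"
    "c *\<^sub>C d *\<^sub>C u = (c * d) *\<^sub>C u" "1 *\<^sub>C u = u"
    "(c *\<^sub>C u) * v = c *\<^sub>C (u * v)" "u * (c *\<^sub>C v) = c *\<^sub>C (u * v)"
    by (transfer; simp add: two_sided_ideal.zero scaleC_add_left scaleC_add_right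
        left free_algebra_scaleC_right)+
qed

end

lift_definition uea_incl :: "'l::complex_lie_algebra \<Rightarrow> 'l uea" is free_gen .

lemma uea_incl_add: "uea_incl (x + y) = uea_incl x + uea_incl y"
  by transfer (rule two_sided_ideal.base, unfold uea_relators_def diff_diff_eq[symmetric], blast)

lemma uea_incl_scaleC: "uea_incl (c *\<^sub>C x) = c *\<^sub>C uea_incl x"
  by transfer (rule two_sided_ideal.base, unfold uea_relators_def, blast)

lemma uea_incl_lie: "uea_incl (lie x y) = uea_incl x * uea_incl y - uea_incl y * uea_incl x"
proof -
  have "uea_incl x * uea_incl y - uea_incl y * uea_incl x = uea_incl (lie x y)"
    by transfer (rule two_sided_ideal.base, unfold uea_relators_def, blast)
  then show ?thesis by simp
qed


section \<open>The general linear Lie algebra\<close>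

text \<open>\<open>'n gl\<close> is \<open>gl\<^sub>N(\<complex>)\<close> with \<open>N = CARD('n)\<close>; row and column indices range over \<open>'n\<close>.\<close>

typedef 'n gl = "UNIV :: (complex ^ 'n ^ 'n) set"
  morphisms mat_of_gl gl_of_mat ..

setup_lifting type_definition_gl

instantiation gl :: (finite) complex_lie_algebra
begin

lift_definition zero_gl :: "'a gl" is 0 .
lift_definition plus_gl :: "'a gl \<Rightarrow> 'a gl \<Rightarrow> 'a gl" is "(+)" .
lift_definition uminus_gl :: "'a gl \<Rightarrow> 'a gl" is uminus .
lift_definition minus_gl :: "'a gl \<Rightarrow> 'a gl \<Rightarrow> 'a gl" is "(-)" .
lift_definition scaleC_gl :: "complex \<Rightarrow> 'a gl \<Rightarrow> 'a gl" is "\<lambda>c X. \<chi> i j. c * X $ i $ j" .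
lift_definition lie_gl :: "'a gl \<Rightarrow> 'a gl \<Rightarrow> 'a gl" is "\<lambda>X Y. X ** Y - Y ** X" .

instance
proof
  fix X Y Z :: "'a gl" and c d :: complex
  have add_l: "(B + C) ** A = B ** A + C ** A"
    and diff_l: "(B - C) ** A = B ** A - C ** A" and diff_r: "A ** (B - C) = A ** B - A ** C"
    for A B C :: "complex ^ 'a ^ 'a"
    by (simp_all add: vec_eq_iff matrix_matrix_mult_def sum_subtractf sum.distrib algebra_simps)
  show "X + Y + Z = X + (Y + Z)" "X + Y = Y + X" "0 + X = X" "- X + X = 0" "X - Y = X + - Y"
    by (transfer; simp)+
  show "c *\<^sub>C (X + Y) = c *\<^sub>C X + c *\<^sub>C Y" "(c + d) *\<^sub>C X = c *\<^sub>C X + d *\<^sub>C X"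
    "c *\<^sub>C d *\<^sub>C X = (c * d) *\<^sub>C X" "1 *\<^sub>C X = X"
    by (transfer; simp add: vec_eq_iff algebra_simps)+
  show "lie (X + Y) Z = lie X Z + lie Y Z" "lie X (Y + Z) = lie X Y + lie X Z"
    by (transfer; simp add: matrix_add_ldistrib add_l)+
  show "lie (c *\<^sub>C X) Y = c *\<^sub>C lie X Y" "lie X (c *\<^sub>C Y) = c *\<^sub>C lie X Y"
    by (transfer; simp add: vec_eq_iff matrix_matrix_mult_def sum_distrib_left right_diff_distrib
        algebra_simps)+
  show "lie X X = 0" by transfer simp
  show "lie X (lie Y Z) + lie Y (lie Z X) + lie Z (lie X Y) = 0"
    by transfer (simp add: diff_l diff_r matrix_mul_assoc)
qed

end

lift_definition matrix_unit :: "'n::finite \<Rightarrow> 'n \<Rightarrow> 'n gl" is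
  "\<lambda>i j. \<chi> k l. if k = i \<and> l = j then 1 else 0" .

definition E :: "'n::finite \<Rightarrow> 'n \<Rightarrow> 'a::complex_comm_algebra_1 \<Rightarrow> ('n gl, 'a) tensor" where
  "E i j a = matrix_unit i j \<otimes>\<^sub>C a"


section \<open>Circuits\<close>

definition connected_pairs :: "'v \<times> 'v \<Rightarrow> 'v \<times> 'v \<Rightarrow> bool" where
  "connected_pairs p q \<longleftrightarrow> snd p = fst q \<or> fst p = snd q"

definition circuit :: "('v \<times> 'v) set \<Rightarrow> bool" where
  "circuit S \<longleftrightarrow> finite S \<and> S \<noteq> {} \<and>
    inj_on fst S \<and> inj_on snd S \<and>
    fst ` S = snd ` S \<and>
    (\<forall>p\<in>S. \<forall>q\<in>S. (p, q) \<in> {(p, q). p \<in> S \<and> q \<in> S \<and> connected_pairs p q}\<^sup>*)"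

definition index_vars :: "('v \<times> 'v) set \<Rightarrow> 'v set" where
  "index_vars S = fst ` S \<union> snd ` S"

definition disjoint_union_of_circuits :: "('v \<times> 'v) set \<Rightarrow> bool" where
  "disjoint_union_of_circuits S \<longleftrightarrow>
    (\<exists>\<C>. finite \<C> \<and> (\<forall>C\<in>\<C>. circuit C) \<and>
      pairwise (\<lambda>C D. index_vars C \<inter> index_vars D = {}) \<C> \<and> S = \<Union>\<C>)"

definition is_order :: "('v \<times> 'v) set \<Rightarrow> ('v \<times> 'v) list \<Rightarrow> bool" where
  "is_order S \<sigma> \<longleftrightarrow> distinct \<sigma> \<and> set \<sigma> = S"

text \<open>An element of \<open>A\<^sup>m\<close> is a list of length \<open>m\<close>. An assignment is normalised to be \<open>undefined\<close>
  outside the variables occurring in \<open>S\<close>, so that each one is summed over exactly once.\<close>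

definition T_elem ::
    "('v \<times> 'v) set \<Rightarrow> ('v \<times> 'v) list \<Rightarrow> 'a::complex_comm_algebra_1 list \<Rightarrow>
      ('n::finite gl, 'a) tensor uea" where
  "T_elem S \<sigma> a =
    (\<Sum>\<nu> \<in> index_vars S \<rightarrow>\<^sub>E UNIV.
      prod_list (map2 (\<lambda>(x, y) b. uea_incl (E (\<nu> x) (\<nu> y) b)) \<sigma> a))"

end

theory Submission
  imports Defs
begin

text \<open>Bracketing with \<open>x \<otimes> 1\<close> is a derivation, and on a matrix unit it changes one index at a time:
  \<open>[x, E\<^sub>i\<^sub>j(b)] = (\<Sum>p. x\<^sub>p\<^sub>i E\<^sub>p\<^sub>j(b)) - (\<Sum>q. x\<^sub>j\<^sub>q E\<^sub>i\<^sub>q(b))\<close>.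

  To follow the effect on a monomial of \<open>T_elem\<close>, let the start points take their values from one
  assignment \<open>\<alpha>\<close> and the end points from another one, \<open>\<beta>\<close>. In a union of circuits each variable
  \<open>s\<close> is the start point of exactly one pair and the end point of exactly one pair, so the bracket
  of \<open>x\<close> with the monomial of \<open>(\<alpha>, \<beta>)\<close> is a sum over the variables \<open>s\<close>: replace the value of \<open>\<alpha>\<close>
  at \<open>s\<close>, say \<open>i\<close>, by \<open>p\<close> with weight \<open>x\<^sub>p\<^sub>i\<close>, and subtract the replacements of the value of
  \<open>\<beta>\<close> at \<open>s\<close>, say \<open>j\<close>, by \<open>q\<close> with weight \<open>x\<^sub>j\<^sub>q\<close> (\<open>word_commutator\<close>).

  Now put \<open>\<alpha> = \<beta> = \<nu>\<close> and sum over \<open>\<nu>\<close>. For fixed \<open>s\<close>, both the positive and the negative terms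
  run over all monomials whose two assignments agree except possibly at \<open>s\<close>; if the start value
  there is \<open>i\<close> and the end value is \<open>j\<close>, the weight is \<open>x\<^sub>i\<^sub>j\<close> in both. Hence they cancel
  (\<open>sum_fun_upd_exchange\<close>).\<close>

lemma mat_of_gl_sum: "mat_of_gl (sum f I) = (\<Sum>i\<in>I. mat_of_gl (f i))"
  by (induct I rule: infinite_finite_induct) (simp_all add: zero_gl.rep_eq plus_gl.rep_eq)

lemma lie_matrix_unit:
  fixes x :: "'n::finite gl"
  shows "lie x (matrix_unit i j) =
    (\<Sum>p\<in>UNIV. mat_of_gl x $ p $ i *\<^sub>C matrix_unit p j) -
    (\<Sum>q\<in>UNIV. mat_of_gl x $ j $ q *\<^sub>C matrix_unit i q)"
proof -
  have "mat_of_gl (lie x (matrix_unit i j)) =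
    mat_of_gl ((\<Sum>p\<in>UNIV. mat_of_gl x $ p $ i *\<^sub>C matrix_unit p j) -
      (\<Sum>q\<in>UNIV. mat_of_gl x $ j $ q *\<^sub>C matrix_unit i q))"
  proof (simp only: vec_eq_iff, intro allI)
    fix k l
    have a: "(\<Sum>r\<in>UNIV. mat_of_gl x $ k $ r * (if r = i \<and> l = j then 1 else 0)) =
        (\<Sum>p\<in>UNIV. mat_of_gl x $ p $ i * (if k = p \<and> l = j then 1 else 0))"
      by (cases "l = j") (simp_all add: if_distrib cong: if_cong)
    have b: "(\<Sum>r\<in>UNIV. (if k = i \<and> r = j then 1 else 0) * mat_of_gl x $ r $ l) =
        (\<Sum>q\<in>UNIV. mat_of_gl x $ j $ q * (if k = i \<and> l = q then 1 else 0))"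
      by (cases "k = i") (simp_all add: if_distrib if_distribR cong: if_cong)
    show "mat_of_gl (lie x (matrix_unit i j)) $ k $ l =
      mat_of_gl ((\<Sum>p\<in>UNIV. mat_of_gl x $ p $ i *\<^sub>C matrix_unit p j) -
        (\<Sum>q\<in>UNIV. mat_of_gl x $ j $ q *\<^sub>C matrix_unit i q)) $ k $ l"
      using a b by (simp add: lie_gl.rep_eq minus_gl.rep_eq mat_of_gl_sum scaleC_gl.rep_eq
          matrix_unit.rep_eq matrix_matrix_mult_def)
  qed
  then show ?thesis by (simp only: mat_of_gl_inject)
qed

lemma additive_E: "Modules.additive (\<lambda>y. uea_incl (y \<otimes>\<^sub>C b))"
  for b :: "'a::complex_comm_algebra_1"
  by unfold_locales (simp add: pure_tensor_add_left uea_incl_add)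

lemma commutator_E:
  fixes x :: "'n::finite gl" and b :: "'a::complex_comm_algebra_1"
  shows "uea_incl (x \<otimes>\<^sub>C 1) * uea_incl (E i j b) - uea_incl (E i j b) * uea_incl (x \<otimes>\<^sub>C 1) =
    (\<Sum>p\<in>UNIV. mat_of_gl x $ p $ i *\<^sub>C uea_incl (E p j b)) -
    (\<Sum>q\<in>UNIV. mat_of_gl x $ j $ q *\<^sub>C uea_incl (E i q b))"
proof -
  have "uea_incl (x \<otimes>\<^sub>C 1) * uea_incl (E i j b) - uea_incl (E i j b) * uea_incl (x \<otimes>\<^sub>C 1) =
      uea_incl (lie x (matrix_unit i j) \<otimes>\<^sub>C b)"
    by (simp add: E_def uea_incl_lie[symmetric] lie_pure_tensor)
  then show ?thesis
    by (simp add: lie_matrix_unit additive.diff[OF additive_E] additive.sum[OF additive_E]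
        pure_tensor_scaleC_left uea_incl_scaleC E_def)
qed

definition word ::
    "('v \<times> 'v) list \<Rightarrow> 'a::complex_comm_algebra_1 list \<Rightarrow> ('v \<Rightarrow> 'n::finite) \<Rightarrow> ('v \<Rightarrow> 'n) \<Rightarrow>
      ('n gl, 'a) tensor uea" where
  "word \<sigma> a \<alpha> \<beta> = prod_list (map2 (\<lambda>(s, t) b. uea_incl (E (\<alpha> s) (\<beta> t) b)) \<sigma> a)"

lemma word_Nil [simp]: "word [] [] \<alpha> \<beta> = 1"
  by (simp add: word_def)

lemma word_Cons [simp]:
  "word ((s, t) # \<sigma>) (b # a) \<alpha> \<beta> = uea_incl (E (\<alpha> s) (\<beta> t) b) * word \<sigma> a \<alpha> \<beta>"
  by (simp add: word_def)

lemma word_cong: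
  assumes "\<And>s. s \<in> fst ` set \<sigma> \<Longrightarrow> \<alpha> s = \<alpha>' s" and "\<And>t. t \<in> snd ` set \<sigma> \<Longrightarrow> \<beta> t = \<beta>' t"
  shows "word \<sigma> a \<alpha> \<beta> = word \<sigma> a \<alpha>' \<beta>'"
proof -
  have "map2 (\<lambda>(s, t) b. uea_incl (E (\<alpha> s) (\<beta> t) b)) \<sigma> a =
      map2 (\<lambda>(s, t) b. uea_incl (E (\<alpha>' s) (\<beta>' t) b)) \<sigma> a"
  proof (intro map_cong refl)
    fix z assume "z \<in> set (zip \<sigma> a)"
    then obtain s t b where z: "z = ((s, t), b)" and "(s, t) \<in> set \<sigma>"
      by (metis prod.exhaust set_zip_leftD)
    then have "\<alpha> s = \<alpha>' s" "\<beta> t = \<beta>' t" using assms by force+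
    then show "(case z of (p, b) \<Rightarrow> (case p of (s, t) \<Rightarrow> \<lambda>b. uea_incl (E (\<alpha> s) (\<beta> t) b)) b) =
        (case z of (p, b) \<Rightarrow> (case p of (s, t) \<Rightarrow> \<lambda>b. uea_incl (E (\<alpha>' s) (\<beta>' t) b)) b)"
      by (simp add: z)
  qed
  then show ?thesis by (simp only: word_def)
qed

text \<open>The Leibniz rule for the derivation \<open>[x, _]\<close>. Since no variable is the start point of two
  pairs, changing the start value of one factor is the same as changing the value of \<open>\<alpha>\<close> at its
  start point, and likewise for end points.\<close>

lemma word_commutator:
  fixes x :: "'n::finite gl" and \<alpha> \<beta> :: "'v \<Rightarrow> 'n"
  assumes "length \<sigma> = length a" and "distinct (map fst \<sigma>)" and "distinct (map snd \<sigma>)"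
  shows "uea_incl (x \<otimes>\<^sub>C 1) * word \<sigma> a \<alpha> \<beta> - word \<sigma> a \<alpha> \<beta> * uea_incl (x \<otimes>\<^sub>C 1) =
    (\<Sum>s\<in>fst ` set \<sigma>. \<Sum>p\<in>UNIV. mat_of_gl x $ p $ \<alpha> s *\<^sub>C word \<sigma> a (\<alpha>(s := p)) \<beta>) -
    (\<Sum>t\<in>snd ` set \<sigma>. \<Sum>q\<in>UNIV. mat_of_gl x $ \<beta> t $ q *\<^sub>C word \<sigma> a \<alpha> (\<beta>(t := q)))"
  using assms
proof (induct \<sigma> a rule: list_induct2)
  case Nil
  show ?case by simp
next
  case (Cons st \<sigma> b a)
  obtain s0 t0 where st: "st = (s0, t0)" by force
  have dist: "distinct (map fst \<sigma>)" "distinct (map snd \<sigma>)"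
    using Cons.prems by simp_all
  note IH = Cons.hyps(2)[OF dist]
  let ?X = "uea_incl (x \<otimes>\<^sub>C 1) :: ('n gl, 'a) tensor uea"
  let ?W = "word \<sigma> a \<alpha> \<beta>" and ?e = "uea_incl (E (\<alpha> s0) (\<beta> t0) b)"
  have s0: "s0 \<notin> fst ` set \<sigma>" and t0: "t0 \<notin> snd ` set \<sigma>"
    using Cons.prems by (auto simp: st image_iff)
  have Ws: "word \<sigma> a (\<alpha>(s0 := p)) \<beta> = ?W" for p
    by (rule word_cong) (use s0 in auto)
  have Wt: "word \<sigma> a \<alpha> (\<beta>(t0 := q)) = ?W" for q
    by (rule word_cong) (use t0 in auto)
  have starts: "(\<Sum>s\<in>fst ` set (st # \<sigma>). \<Sum>p\<in>UNIV.
        mat_of_gl x $ p $ \<alpha> s *\<^sub>C word (st # \<sigma>) (b # a) (\<alpha>(s := p)) \<beta>) =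
      (\<Sum>p\<in>UNIV. mat_of_gl x $ p $ \<alpha> s0 *\<^sub>C uea_incl (E p (\<beta> t0) b)) * ?W +
      ?e * (\<Sum>s\<in>fst ` set \<sigma>. \<Sum>p\<in>UNIV. mat_of_gl x $ p $ \<alpha> s *\<^sub>C word \<sigma> a (\<alpha>(s := p)) \<beta>)"
  proof -
    have "uea_incl (E ((\<alpha>(s := p)) s0) (\<beta> t0) b) = ?e" if "s \<in> fst ` set \<sigma>" for s p
      using that s0 by auto
    then show ?thesis
      using s0 by (simp add: st Ws sum_distrib_left sum_distrib_right scaleC_mult_left
          scaleC_mult_right cong: sum.cong)
  qed
  have ends: "(\<Sum>t\<in>snd ` set (st # \<sigma>). \<Sum>q\<in>UNIV.
        mat_of_gl x $ \<beta> t $ q *\<^sub>C word (st # \<sigma>) (b # a) \<alpha> (\<beta>(t := q))) =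
      (\<Sum>q\<in>UNIV. mat_of_gl x $ \<beta> t0 $ q *\<^sub>C uea_incl (E (\<alpha> s0) q b)) * ?W +
      ?e * (\<Sum>t\<in>snd ` set \<sigma>. \<Sum>q\<in>UNIV. mat_of_gl x $ \<beta> t $ q *\<^sub>C word \<sigma> a \<alpha> (\<beta>(t := q)))"
  proof -
    have "uea_incl (E (\<alpha> s0) ((\<beta>(t := q)) t0) b) = ?e" if "t \<in> snd ` set \<sigma>" for t q
      using that t0 by auto
    then show ?thesis
      using t0 by (simp add: st Wt sum_distrib_left sum_distrib_right scaleC_mult_left
          scaleC_mult_right cong: sum.cong)
  qed
  have "?X * (?e * ?W) - ?e * ?W * ?X = (?X * ?e - ?e * ?X) * ?W + ?e * (?X * ?W - ?W * ?X)"
    by (simp add: algebra_simps)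
  also have "\<dots> = ((\<Sum>p\<in>UNIV. mat_of_gl x $ p $ \<alpha> s0 *\<^sub>C uea_incl (E p (\<beta> t0) b)) -
        (\<Sum>q\<in>UNIV. mat_of_gl x $ \<beta> t0 $ q *\<^sub>C uea_incl (E (\<alpha> s0) q b))) * ?W +
      ?e * ((\<Sum>s\<in>fst ` set \<sigma>. \<Sum>p\<in>UNIV. mat_of_gl x $ p $ \<alpha> s *\<^sub>C word \<sigma> a (\<alpha>(s := p)) \<beta>) -
        (\<Sum>t\<in>snd ` set \<sigma>. \<Sum>q\<in>UNIV. mat_of_gl x $ \<beta> t $ q *\<^sub>C word \<sigma> a \<alpha> (\<beta>(t := q))))"
    by (simp only: commutator_E IH)
  finally show ?case
    unfolding starts ends by (simp add: st left_diff_distrib right_diff_distrib)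
qed

text \<open>The involution \<open>(\<nu>, p) \<mapsto> (\<nu>(s := p), \<nu> s)\<close> exchanges the roles of the old and the new value
  at \<open>s\<close>, and with them the two assignments.\<close>

lemma sum_fun_upd_exchange:
  fixes F :: "('v \<Rightarrow> 'n::finite) \<Rightarrow> ('v \<Rightarrow> 'n) \<Rightarrow> 'c::complex_vector"
  assumes "s \<in> V"
  shows "(\<Sum>\<nu>\<in>V \<rightarrow>\<^sub>E UNIV. \<Sum>p\<in>UNIV. c p (\<nu> s) *\<^sub>C F (\<nu>(s := p)) \<nu>) =
    (\<Sum>\<nu>\<in>V \<rightarrow>\<^sub>E UNIV. \<Sum>q\<in>UNIV. c (\<nu> s) q *\<^sub>C F \<nu> (\<nu>(s := q)))"
  unfolding sum.cartesian_product
  by (rule sum.reindex_bij_witness[where i = "\<lambda>(\<nu>, p). (\<nu>(s := p), \<nu> s)"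
        and j = "\<lambda>(\<nu>, p). (\<nu>(s := p), \<nu> s)"])
    (use assms in \<open>auto simp: PiE_iff extensional_def\<close>)

text \<open>Two pairs that share a variable lie in the same circuit, where these properties hold.\<close>

lemma disjoint_union_of_circuits_starts_ends:
  assumes "disjoint_union_of_circuits S"
  shows "inj_on fst S" and "inj_on snd S" and "fst ` S = snd ` S"
proof -
  obtain \<C> where circ: "\<And>C. C \<in> \<C> \<Longrightarrow> circuit C" and S: "S = \<Union>\<C>"
    and disj: "pairwise (\<lambda>C D. index_vars C \<inter> index_vars D = {}) \<C>"
    using assms unfolding disjoint_union_of_circuits_def by blast
  have same: "C = D" if "C \<in> \<C>" "D \<in> \<C>" "v \<in> index_vars C" "v \<in> index_vars D" for C D v
    using disj that unfolding pairwise_def by blast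
  show "inj_on fst S"
  proof (rule inj_onI)
    fix p q assume "p \<in> S" "q \<in> S" and eq: "fst p = fst q"
    then obtain C D where C: "C \<in> \<C>" "p \<in> C" and D: "D \<in> \<C>" "q \<in> D" by (auto simp: S)
    have "fst p \<in> index_vars C" "fst p \<in> index_vars D"
      unfolding index_vars_def using C(2) D(2) eq by (metis UnCI imageI)+
    then have "C = D" by (rule same[OF C(1) D(1)])
    then show "p = q" using circ[OF C(1)] C D eq by (auto simp: circuit_def dest: inj_onD)
  qed
  show "inj_on snd S"
  proof (rule inj_onI)
    fix p q assume "p \<in> S" "q \<in> S" and eq: "snd p = snd q"
    then obtain C D where C: "C \<in> \<C>" "p \<in> C" and D: "D \<in> \<C>" "q \<in> D" by (auto simp: S)
    have "snd p \<in> index_vars C" "snd p \<in> index_vars D"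
      unfolding index_vars_def using C(2) D(2) eq by (metis UnCI imageI)+
    then have "C = D" by (rule same[OF C(1) D(1)])
    then show "p = q" using circ[OF C(1)] C D eq by (auto simp: circuit_def dest: inj_onD)
  qed
  show "fst ` S = snd ` S"
    using circ by (simp add: S image_Union circuit_def)
qed

theorem proposition5p7:
  fixes S :: "('v \<times> 'v) set"
    and \<sigma> :: "('v \<times> 'v) list"
    and a :: "'a::complex_comm_algebra_1 list"
    and m :: nat
  assumes "disjoint_union_of_circuits S"
    and "m = card S" and "m \<ge> 1"
    and "is_order S \<sigma>"
    and "length a = m"
  shows "\<forall>x :: 'n::finite gl.
    T_elem S \<sigma> a * uea_incl (x \<otimes>\<^sub>C 1) = uea_incl (x \<otimes>\<^sub>C 1) * T_elem S \<sigma> a"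
proof
  fix x :: "'n gl"
  let ?X = "uea_incl (x \<otimes>\<^sub>C 1) :: ('n gl, 'a) tensor uea"
  let ?N = "index_vars S \<rightarrow>\<^sub>E (UNIV :: 'n set)"
  note circuits = disjoint_union_of_circuits_starts_ends[OF assms(1)]
  have \<sigma>: "distinct \<sigma>" "set \<sigma> = S" using assms(4) by (auto simp: is_order_def)
  have len: "length \<sigma> = length a" using assms \<sigma> distinct_card[of \<sigma>] by simp
  have V: "fst ` set \<sigma> = index_vars S" "snd ` set \<sigma> = index_vars S"
    using circuits(3) by (simp_all add: index_vars_def \<sigma>)
  have dist: "distinct (map fst \<sigma>)" "distinct (map snd \<sigma>)"
    using circuits \<sigma> by (simp_all add: distinct_map)
  have T: "T_elem S \<sigma> a = (\<Sum>\<nu>\<in>?N. word \<sigma> a \<nu> \<nu>)"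
    by (simp add: T_elem_def word_def)
  have "?X * T_elem S \<sigma> a - T_elem S \<sigma> a * ?X =
      (\<Sum>\<nu>\<in>?N. ?X * word \<sigma> a \<nu> \<nu> - word \<sigma> a \<nu> \<nu> * ?X)"
    by (simp add: T sum_distrib_left sum_distrib_right sum_subtractf)
  also have "\<dots> =
      (\<Sum>\<nu>\<in>?N. \<Sum>s\<in>index_vars S. \<Sum>p\<in>UNIV. mat_of_gl x $ p $ \<nu> s *\<^sub>C word \<sigma> a (\<nu>(s := p)) \<nu>) -
      (\<Sum>\<nu>\<in>?N. \<Sum>s\<in>index_vars S. \<Sum>q\<in>UNIV. mat_of_gl x $ \<nu> s $ q *\<^sub>C word \<sigma> a \<nu> (\<nu>(s := q)))"
    by (simp add: word_commutator[OF len dist] V sum_subtractf)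
  also have "\<dots> =
      (\<Sum>s\<in>index_vars S. \<Sum>\<nu>\<in>?N. \<Sum>p\<in>UNIV. mat_of_gl x $ p $ \<nu> s *\<^sub>C word \<sigma> a (\<nu>(s := p)) \<nu>) -
      (\<Sum>s\<in>index_vars S. \<Sum>\<nu>\<in>?N. \<Sum>q\<in>UNIV. mat_of_gl x $ \<nu> s $ q *\<^sub>C word \<sigma> a \<nu> (\<nu>(s := q)))"
    by (simp only: sum.swap[of _ "index_vars S" ?N])
  also have "\<dots> = 0"
    by (simp add: sum_fun_upd_exchange[where c = "\<lambda>i j. mat_of_gl x $ i $ j" and F = "word \<sigma> a"])
  finally show "T_elem S \<sigma> a * ?X = ?X * T_elem S \<sigma> a" by simp
qed

end
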